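(* Let $p$ be a prime. There is a constant $c>1$, depending only on $p$, such that the following holds. For every positive integer $N$, every matrix $A\in\{-1,1\}^{N\times N}$, and every nonnegative integer $r$, letting $\sigma_1$ denote the largest singular value of $A$ regarded as a complex matrix, $$\mathcal{R}^{\mathrm{bool},p}_{A}(r)\;\ge\; N^2\left(\frac12-\frac{c^r\,\sigma_1}{N}\right).$$
   Context: $\mathbb{F}_p$ is the field with $p$ elements. For $x\in\mathbb{F}_p$ define its Booleanization $\mathrm{bool}(x)=1$ if $x=1$ in $\mathbb{F}_p$ and $\mathrm{bool}(x)=-1$ otherwise. For a matrix $A\in\{-1,1\}^{N\times N}$ and an integer $r\ge 0$, the Boolean rigidity $\mathcal{R}^{\mathrm{bool},p}_{A}(r)$ is the minimum, over all matrices $L\in\mathbb{F}_p^{N\times N}$ of rank at most $r$ over $\mathbb{F}_p$, of the number of index pairs $(i,j)$ with $A[i,j]\neq \mathrm{bool}(L[i,j])$. *)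

theory Defs
  imports
    "Jordan_Normal_Form.DL_Rank"
    "Jordan_Normal_Form.Schur_Decomposition"
    "Jordan_Normal_Form.Spectral_Radius"
    "Berlekamp_Zassenhaus.Finite_Field"
begin

definition booleanize :: "'p::prime_card mod_ring \<Rightarrow> int" where
  "booleanize x = (if x = 1 then 1 else - 1)"

definition bool_disagreement :: "int mat \<Rightarrow> 'p::prime_card mod_ring mat \<Rightarrow> nat" where
  "bool_disagreement A L =
     card {(i, j). i < dim_row A \<and> j < dim_col A \<and> A $$ (i, j) \<noteq> booleanize (L $$ (i, j))}"

text \<open>The prime \<open>p\<close> is \<open>CARD('p)\<close>, passed as a type argument. The set of attained values is
  finite and contains the value at \<open>L = 0\<close> (see below), so \<^const>\<open>Min\<close> is a genuine minimum.\<close>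

definition bool_rigidity :: "'p::prime_card itself \<Rightarrow> int mat \<Rightarrow> nat \<Rightarrow> nat" where
  "bool_rigidity _ A r =
     Min {bool_disagreement A L | L :: 'p mod_ring mat.
            L \<in> carrier_mat (dim_row A) (dim_col A) \<and> vec_space.rank (dim_row A) L \<le> r}"

definition singular_values :: "complex mat \<Rightarrow> real set" where
  "singular_values A =
     {\<sigma>. \<sigma> \<ge> 0 \<and> eigenvalue (mat_adjoint A * A) (complex_of_real (\<sigma>\<^sup>2))}"

definition largest_singular_value :: "complex mat \<Rightarrow> real" where
  "largest_singular_value A = Max (singular_values A)"

lemma bool_disagreement_le: "bool_disagreement A L \<le> dim_row A * dim_col A"
proof -
  have "bool_disagreement A L \<le> card ({..<dim_row A} \<times> {..<dim_col A})"
    unfolding bool_disagreement_def by (intro card_mono) auto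
  then show ?thesis by simp
qed

lemma bool_rigidity_set_finite:
  "finite {bool_disagreement A L | L :: 'p::prime_card mod_ring mat.
     L \<in> carrier_mat (dim_row A) (dim_col A) \<and> vec_space.rank (dim_row A) L \<le> r}"
  by (rule finite_subset[of _ "{..dim_row A * dim_col A}"]) (auto intro: bool_disagreement_le)

lemma rank_zero_mat: "vec_space.rank n (0\<^sub>m n m :: 'a::field mat) = 0"
proof -
  interpret vec_space "TYPE('a)" n .
  have cols: "set (cols (0\<^sub>m n m :: 'a mat)) \<subseteq> {0\<^sub>v n}"
    by (auto simp: cols_def)
  obtain U where U: "maximal U (\<lambda>T. T \<subseteq> set (cols (0\<^sub>m n m :: 'a mat)) \<and> lin_indpt T)"
    using maximal_exists[of "\<lambda>T. T \<subseteq> set (cols (0\<^sub>m n m :: 'a mat)) \<and> lin_indpt T"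
        "card (set (cols (0\<^sub>m n m :: 'a mat)))" "{}"]
    by (meson List.finite_set card_mono empty_iff empty_subsetI finite_lin_indpt2 rev_finite_subset)
  then have "U \<subseteq> {0\<^sub>v n}" "lin_indpt U" using cols unfolding maximal_def by auto
  moreover from this have "0\<^sub>v n \<notin> U"
  proof -
    have "U \<subseteq> carrier_vec n" using \<open>U \<subseteq> {0\<^sub>v n}\<close> zero_carrier_vec by blast
    moreover have "(UNIV :: 'a set) \<noteq> {0}" using zero_neq_one by (metis UNIV_I singletonD)
    ultimately show ?thesis
      using zero_nin_lin_indpt[of U] \<open>lin_indpt U\<close> by (auto simp: module_vec_simps)
  qed
  ultimately have "U = {}" by auto
  then show ?thesis using rank_card_indpt[OF zero_carrier_mat U] by simp
qed

lemma bool_rigidity_attained: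
  "\<exists>L :: 'p::prime_card mod_ring mat. L \<in> carrier_mat (dim_row A) (dim_col A) \<and>
     vec_space.rank (dim_row A) L \<le> r \<and> bool_rigidity TYPE('p) A r = bool_disagreement A L"
proof -
  have "{bool_disagreement A L | L :: 'p mod_ring mat.
     L \<in> carrier_mat (dim_row A) (dim_col A) \<and> vec_space.rank (dim_row A) L \<le> r} \<noteq> {}"
    using rank_zero_mat[where 'a = "'p mod_ring"] zero_carrier_mat by (metis (mono_tags, lifting) empty_Collect_eq le0)
  from Min_in[OF bool_rigidity_set_finite this] show ?thesis
    unfolding bool_rigidity_def by blast
qed

lemma adjoint_mult_eigenvalue_nonneg:
  assumes A: "A \<in> carrier_mat n m" and ev: "eigenvalue (mat_adjoint A * A) k"
  shows "\<exists>\<sigma>\<ge>0. k = complex_of_real (\<sigma>\<^sup>2)"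
proof -
  have adj: "mat_adjoint A \<in> carrier_mat m n"
    using A unfolding mat_adjoint_def by auto
  from ev obtain v where v: "v \<in> carrier_vec m" "v \<noteq> 0\<^sub>v m"
    and eq: "(mat_adjoint A * A) *\<^sub>v v = k \<cdot>\<^sub>v v"
    unfolding eigenvalue_def eigenvector_def using adj by auto
  define w where "w = A *\<^sub>v v"
  have w: "w \<in> carrier_vec n" using A v unfolding w_def by auto
  have "mat_adjoint A *\<^sub>v w = k \<cdot>\<^sub>v v"
    using eq A adj v unfolding w_def by (simp add: assoc_mult_mat_vec)
  then have "k * (v \<bullet>c v) = (mat_adjoint A *\<^sub>v w) \<bullet>c v"
    using v by simp
  also have "\<dots> = (\<Sum>j<m. (\<Sum>i<n. cnj (A $$ (i, j)) * w $ i) * cnj (v $ j))"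
    using A adj v w
    by (auto simp: scalar_prod_def mat_adjoint_def mat_of_rows_def lessThan_atLeast0 intro!: sum.cong)
  also have "\<dots> = (\<Sum>i<n. w $ i * cnj (\<Sum>j<m. A $$ (i, j) * v $ j))"
    by (simp add: sum_distrib_left sum_distrib_right mult_ac) (rule sum.swap)
  also have "\<dots> = w \<bullet>c w"
    using A v w unfolding w_def
    by (auto simp: scalar_prod_def lessThan_atLeast0 intro!: sum.cong)
  finally have *: "k * (v \<bullet>c v) = w \<bullet>c w" .
  have sq: "\<exists>x\<ge>0. u \<bullet>c u = complex_of_real x" if "u \<in> carrier_vec d" for u :: "complex vec" and d
  proof (intro exI conjI)
    show "u \<bullet>c u = complex_of_real (\<Sum>i<d. (cmod (u $ i))\<^sup>2)"
      using that by (auto simp: scalar_prod_def lessThan_atLeast0 complex_norm_square[symmetric] intro!: sum.cong)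
  qed (simp add: sum_nonneg)
  obtain x y where x: "x \<ge> 0" "v \<bullet>c v = complex_of_real x" and y: "y \<ge> 0" "w \<bullet>c w = complex_of_real y"
    using sq[OF v(1)] sq[OF w] by blast
  have "v \<bullet>c v \<noteq> 0" using v by (simp add: conjugate_square_eq_0_vec)
  then have "k = complex_of_real (y / x)" using * x y by (simp add: field_simps)
  then show ?thesis using x y by (intro exI[of _ "sqrt (y / x)"]) simp
qed

lemma finite_singular_values:
  assumes "A \<in> carrier_mat n m"
  shows "finite (singular_values A)"
proof -
  have sq: "mat_adjoint A * A \<in> carrier_mat m m"
    using assms unfolding mat_adjoint_def by auto
  have "finite (spectrum (mat_adjoint A * A))"
    using card_finite_spectrum(1)[OF sq] .
  moreover have "(\<lambda>\<sigma>. complex_of_real (\<sigma>\<^sup>2)) ` singular_values A \<subseteq> spectrum (mat_adjoint A * A)"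
    unfolding singular_values_def spectrum_def by auto
  moreover have "inj_on (\<lambda>\<sigma>. complex_of_real (\<sigma>\<^sup>2)) (singular_values A)"
    unfolding inj_on_def of_real_eq_iff by (simp add: singular_values_def)
  ultimately show ?thesis by (metis finite_imageD finite_subset)
qed

lemma singular_values_nonempty:
  assumes A: "A \<in> carrier_mat n m" and "m > 0"
  shows "singular_values A \<noteq> {}"
proof -
  have sq: "mat_adjoint A * A \<in> carrier_mat m m"
    using A unfolding mat_adjoint_def by auto
  from spectrum_non_empty[OF sq] \<open>m > 0\<close> obtain k where "eigenvalue (mat_adjoint A * A) k"
    unfolding spectrum_def by auto
  with adjoint_mult_eigenvalue_nonneg[OF A this] show ?thesis
    unfolding singular_values_def by auto
qed

end

theory Submission
  imports Defs "HOL-Analysis.Convex"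
begin

text \<open>
  A matrix \<open>L\<close> of rank at most \<open>r\<close> over \<open>\<bbbF>\<^sub>p\<close> has at most \<open>p ^ r\<close> distinct columns. Grouping equal
  columns, the inner product of \<open>A\<close> with the Booleanization of \<open>L\<close> is a sum of at most \<open>p ^ r\<close>
  terms \<open>b\<^sup>T A 1\<^sub>S\<close> with \<open>b\<close> a sign vector and \<open>S\<close> a set of columns, each bounded by
  \<open>\<sigma>\<^sub>1 \<parallel>b\<parallel> \<parallel>1\<^sub>S\<parallel> \<le> \<sigma>\<^sub>1 N\<close>. As this inner product is \<open>N\<^sup>2\<close> minus twice the number of
  disagreements, \<open>c = p\<close> works.
\<close>

section \<open>Squared Euclidean norm, Cauchy-Schwarz and the adjoint\<close>

definition vnorm2 :: "complex vec \<Rightarrow> real" where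
  "vnorm2 v = (\<Sum>i<dim_vec v. (cmod (v $ i))\<^sup>2)"

lemma vnorm2_nonneg: "vnorm2 v \<ge> 0"
  by (simp add: vnorm2_def sum_nonneg)

lemma cscalar_prod_self: "v \<bullet>c v = complex_of_real (vnorm2 v)"
  by (auto simp: vnorm2_def scalar_prod_def lessThan_atLeast0 complex_norm_square[symmetric]
      intro!: sum.cong)

lemma vnorm2_smult: "vnorm2 (a \<cdot>\<^sub>v v) = (cmod a)\<^sup>2 * vnorm2 v"
  by (simp add: vnorm2_def norm_mult power_mult_distrib sum_distrib_left)

lemma cscalar_prod_cauchy_schwarz:
  assumes "v \<in> carrier_vec n" "w \<in> carrier_vec n"
  shows "(cmod (v \<bullet>c w))\<^sup>2 \<le> vnorm2 v * vnorm2 w"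
proof -
  have "cmod (v \<bullet>c w) \<le> (\<Sum>i<n. cmod (v $ i) * cmod (w $ i))"
    using assms by (auto simp: scalar_prod_def lessThan_atLeast0 norm_mult intro!: sum_norm_le)
  then have "(cmod (v \<bullet>c w))\<^sup>2 \<le> (\<Sum>i<n. cmod (v $ i) * cmod (w $ i))\<^sup>2"
    by (intro power_mono) auto
  also have "\<dots> \<le> vnorm2 v * vnorm2 w"
    unfolding vnorm2_def carrier_vecD[OF assms(1)] carrier_vecD[OF assms(2)]
    by (rule Cauchy_Schwarz_ineq_sum)
  finally show ?thesis .
qed

lemma mat_adjoint_carrier:
  "A \<in> carrier_mat n m \<Longrightarrow> mat_adjoint A \<in> carrier_mat m n"
  unfolding mat_adjoint_def by auto

lemma cscalar_prod_mat_adjoint: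
  fixes A :: "complex mat"
  assumes A: "A \<in> carrier_mat n m" and x: "x \<in> carrier_vec m" and y: "y \<in> carrier_vec n"
  shows "(A *\<^sub>v x) \<bullet>c y = x \<bullet>c (mat_adjoint A *\<^sub>v y)"
proof -
  have adj: "mat_adjoint A \<in> carrier_mat m n"
    using A by (rule mat_adjoint_carrier)
  have "(A *\<^sub>v x) \<bullet>c y = (\<Sum>i<n. (\<Sum>j<m. A $$ (i, j) * x $ j) * cnj (y $ i))"
    using A x y by (auto simp: scalar_prod_def lessThan_atLeast0 intro!: sum.cong)
  also have "\<dots> = (\<Sum>j<m. x $ j * cnj (\<Sum>i<n. cnj (A $$ (i, j)) * y $ i))"
    by (simp add: sum_distrib_left sum_distrib_right mult_ac) (rule sum.swap)
  also have "\<dots> = x \<bullet>c (mat_adjoint A *\<^sub>v y)"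
    using A adj x y
    by (auto simp: scalar_prod_def mat_adjoint_def mat_of_rows_def lessThan_atLeast0 intro!: sum.cong)
  finally show ?thesis .
qed

text \<open>Each coordinate of the image is at most \<open>c\<close> times the l1 norm of
  \<open>x\<close>. The bound is crude but depends on the entries only through \<open>c\<close>, so
  one constant serves all powers of a matrix with uniformly bounded powers.\<close>

lemma vnorm2_mult_le_norm_bound:
  assumes A: "A \<in> carrier_mat n m" and x: "x \<in> carrier_vec m" and c: "norm_bound A c"
  shows "vnorm2 (A *\<^sub>v x) \<le> n * (c * (\<Sum>j<m. cmod (x $ j)))\<^sup>2"
proof -
  have "cmod ((A *\<^sub>v x) $ i) \<le> c * (\<Sum>j<m. cmod (x $ j))" if i: "i < n" for i
  proof -
    have "(A *\<^sub>v x) $ i = (\<Sum>j<m. A $$ (i, j) * x $ j)"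
      using A x i by (auto simp: scalar_prod_def lessThan_atLeast0 intro!: sum.cong)
    also have "cmod \<dots> \<le> (\<Sum>j<m. c * cmod (x $ j))"
      using A c i by (intro sum_norm_le) (auto simp: norm_mult norm_bound_def intro!: mult_right_mono)
    finally show ?thesis by (simp add: sum_distrib_left)
  qed
  then have "vnorm2 (A *\<^sub>v x) \<le> (\<Sum>i<n. (c * (\<Sum>j<m. cmod (x $ j)))\<^sup>2)"
    unfolding vnorm2_def using A
    by (auto simp del: index_mult_mat_vec sum_constant intro!: sum_mono power_mono)
  then show ?thesis by simp
qed

section \<open>Powers and norm bounds of self-adjoint matrices\<close>

lemma pow_mat_add_vec:
  fixes H :: "'a::comm_ring_1 mat"
  assumes H: "H \<in> carrier_mat n n" and x: "x \<in> carrier_vec n"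
  shows "H ^\<^sub>m (k + l) *\<^sub>v x = H ^\<^sub>m k *\<^sub>v (H ^\<^sub>m l *\<^sub>v x)"
  using x
\<comment> \<open>A power splits off its last factor on the right, so the induction hypothesis is
  needed at \<open>H\<close> applied to \<open>x\<close>.\<close>
proof (induction l arbitrary: x)
  case (Suc l)
  have "H ^\<^sub>m (k + Suc l) *\<^sub>v x = H ^\<^sub>m (k + l) *\<^sub>v (H *\<^sub>v x)"
    using H Suc.prems by (simp add: assoc_mult_mat_vec[where n\<^sub>1=n and n\<^sub>2=n and n\<^sub>3=n])
  also have "\<dots> = H ^\<^sub>m k *\<^sub>v (H ^\<^sub>m l *\<^sub>v (H *\<^sub>v x))"
    using Suc.IH[of "H *\<^sub>v x"] H Suc.prems by simp
  also have "H ^\<^sub>m l *\<^sub>v (H *\<^sub>v x) = H ^\<^sub>m Suc l *\<^sub>v x"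
    using H Suc.prems by (simp add: assoc_mult_mat_vec[where n\<^sub>1=n and n\<^sub>2=n and n\<^sub>3=n])
  finally show ?case .
qed (use H in simp)

text \<open>Stated through the inner product rather than as an equation of matrices, the form in
  which it is applied to powers and real multiples.\<close>

definition selfadjoint :: "nat \<Rightarrow> complex mat \<Rightarrow> bool" where
  "selfadjoint n H \<longleftrightarrow> H \<in> carrier_mat n n \<and>
     (\<forall>x\<in>carrier_vec n. \<forall>y\<in>carrier_vec n. (H *\<^sub>v x) \<bullet>c y = x \<bullet>c (H *\<^sub>v y))"

lemma selfadjoint_pow:
  assumes H: "selfadjoint n H"
  shows "selfadjoint n (H ^\<^sub>m k)"
proof (induction k)
  case 0
  then show ?case using H by (auto simp: selfadjoint_def)
next
  case (Suc k)
  have c: "H \<in> carrier_mat n n" using H by (simp add: selfadjoint_def)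
  have pc: "H ^\<^sub>m k \<in> carrier_mat n n" using c by simp
  have "(H ^\<^sub>m Suc k *\<^sub>v x) \<bullet>c y = x \<bullet>c (H ^\<^sub>m Suc k *\<^sub>v y)"
    if x: "x \<in> carrier_vec n" and y: "y \<in> carrier_vec n" for x y
  proof -
    have "(H ^\<^sub>m Suc k *\<^sub>v x) \<bullet>c y = (H ^\<^sub>m k *\<^sub>v (H *\<^sub>v x)) \<bullet>c y"
      using c pc x by (simp add: assoc_mult_mat_vec[where n\<^sub>1=n and n\<^sub>2=n and n\<^sub>3=n])
    also have "\<dots> = (H *\<^sub>v x) \<bullet>c (H ^\<^sub>m k *\<^sub>v y)"
      using Suc.IH c x y unfolding selfadjoint_def by (meson mult_mat_vec_carrier)
    also have "\<dots> = x \<bullet>c (H *\<^sub>v (H ^\<^sub>m k *\<^sub>v y))"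
      using H pc x y unfolding selfadjoint_def by (meson mult_mat_vec_carrier)
    also have "H *\<^sub>v (H ^\<^sub>m k *\<^sub>v y) = H ^\<^sub>m Suc k *\<^sub>v y"
      using pow_mat_add_vec[OF c y, of 1 k] c by simp
    finally show ?thesis .
  qed
  then show ?case using c unfolding selfadjoint_def by (auto simp del: pow_mat.simps)
qed

text \<open>
  The powers of \<open>H\<close> are bounded, whereas self-adjointness and Cauchy-Schwarz give
  \<open>\<parallel>H\<^bsup>m\<^esup> x\<parallel>\<^sup>2 \<le> \<parallel>x\<parallel> \<parallel>H\<^bsup>2m\<^esup> x\<parallel>\<close>: if \<open>\<parallel>H x\<parallel> > \<parallel>x\<parallel>\<close>, then \<open>\<parallel>H\<^bsup>m\<^esup> x\<parallel>\<close> would grow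
  exponentially along \<open>m = 2\<^bsup>k\<^esup>\<close>. This avoids the spectral theorem.
\<close>

lemma selfadjoint_contraction:
  assumes H: "selfadjoint n H" and x: "x \<in> carrier_vec n" and sr: "spectral_radius H < 1"
  shows "vnorm2 (H *\<^sub>v x) \<le> vnorm2 x"
proof (rule ccontr)
  assume "\<not> ?thesis"
  then have gt: "vnorm2 (H *\<^sub>v x) > vnorm2 x" by simp
  have c: "H \<in> carrier_mat n n" using H by (simp add: selfadjoint_def)
  obtain b where b: "\<And>k. norm_bound (H ^\<^sub>m k) b"
    using spectral_radius_jnf_norm_bound_less_1_upper_triangular[OF c sr] by blast
  define C where "C = n * (b * (\<Sum>j<n. cmod (x $ j)))\<^sup>2"
  define a where "a k = vnorm2 (H ^\<^sub>m (2 ^ k) *\<^sub>v x)" for k :: nat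
  have a_le: "a k \<le> C" for k
    unfolding a_def C_def using vnorm2_mult_le_norm_bound[OF _ x b] c by simp
  have a0: "a 0 = vnorm2 (H *\<^sub>v x)" using c by (simp add: a_def)
  have step: "(a k)\<^sup>2 \<le> vnorm2 x * a (Suc k)" for k
  proof -
    let ?P = "H ^\<^sub>m (2 ^ k)"
    have P: "?P \<in> carrier_mat n n" using c by simp
    have "complex_of_real (a k) = (?P *\<^sub>v x) \<bullet>c (?P *\<^sub>v x)"
      by (simp add: a_def cscalar_prod_self)
    also have "\<dots> = x \<bullet>c (?P *\<^sub>v (?P *\<^sub>v x))"
      using selfadjoint_pow[OF H, of "2 ^ k"] x P unfolding selfadjoint_def
      by (meson mult_mat_vec_carrier)
    also have "?P *\<^sub>v (?P *\<^sub>v x) = H ^\<^sub>m (2 ^ Suc k) *\<^sub>v x"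
      using pow_mat_add_vec[OF c x, of "2 ^ k" "2 ^ k"] by (simp add: mult_2)
    finally have eq: "complex_of_real (a k) = x \<bullet>c (H ^\<^sub>m (2 ^ Suc k) *\<^sub>v x)" .
    have "(a k)\<^sup>2 = (cmod (complex_of_real (a k)))\<^sup>2" by simp
    also have "\<dots> \<le> vnorm2 x * a (Suc k)"
      unfolding eq unfolding a_def
      by (rule cscalar_prod_cauchy_schwarz[OF x mult_mat_vec_carrier[OF pow_carrier_mat[OF c] x]])
    finally show ?thesis .
  qed
  \<comment> \<open>If this norm vanished, \<open>step\<close> at 0 would force
    \<open>a 0 = 0\<close>, against \<open>gt\<close>. Positivity makes the ratio \<open>q\<close>
    meaningful.\<close>
  have pos: "vnorm2 x > 0"
  proof (rule ccontr)
    assume "\<not> ?thesis"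
    then have "vnorm2 x = 0" using vnorm2_nonneg[of x] by simp
    then show False using step[of 0] gt a0 by simp
  qed
  define q where "q = a 0 / vnorm2 x"
  have q: "q > 1" using gt pos a0 by (simp add: q_def)
  have grow: "a k \<ge> vnorm2 x * q ^ (2 ^ k)" for k
  proof (induction k)
    case 0
    then show ?case using pos by (simp add: q_def)
  next
    case (Suc k)
    have "vnorm2 x * (vnorm2 x * q ^ (2 ^ Suc k)) = (vnorm2 x * q ^ (2 ^ k))\<^sup>2"
      by (simp add: power2_eq_square power_mult mult_2 power_add)
    also have "\<dots> \<le> (a k)\<^sup>2"
      using Suc pos q by (intro power_mono) auto
    also have "\<dots> \<le> vnorm2 x * a (Suc k)" by (rule step)
    finally show ?case using pos by simp
  qed
  obtain m where m: "q ^ m > C / vnorm2 x"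
    using real_arch_pow[OF q] by blast
  have "q ^ m \<le> q ^ (2 ^ m)" using q by (intro power_increasing) auto
  with m have "C / vnorm2 x < q ^ (2 ^ m)" by linarith
  then have "C < vnorm2 x * q ^ (2 ^ m)"
    using pos by (simp add: field_simps)
  with grow[of m] a_le[of m] show False by simp
qed

text \<open>For every \<open>t > \<rho>\<close> the matrix \<open>H\<close> divided by
  \<open>t\<close> has spectral radius below 1 and is thus a contraction; letting \<open>t\<close>
  decrease to \<open>\<rho>\<close> gives the bound.\<close>

lemma selfadjoint_vnorm2_le:
  assumes H: "selfadjoint n H" and n: "n > 0" and x: "x \<in> carrier_vec n"
    and ev: "\<And>k. eigenvalue H k \<Longrightarrow> cmod k \<le> \<rho>"
  shows "vnorm2 (H *\<^sub>v x) \<le> \<rho>\<^sup>2 * vnorm2 x"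
proof -
  have c: "H \<in> carrier_mat n n" using H by (simp add: selfadjoint_def)
  \<comment> \<open>As \<open>n > 0\<close>, some eigenvalue exists, and its modulus lies below
    \<open>\<rho>\<close>.\<close>
  have rho: "\<rho> \<ge> 0"
    using spectrum_non_empty[OF c n] ev norm_ge_zero order_trans unfolding spectrum_def by blast
  have le: "vnorm2 (H *\<^sub>v x) \<le> t\<^sup>2 * vnorm2 x" if t: "t > \<rho>" for t
  proof -
    define K where "K = complex_of_real (1 / t) \<cdot>\<^sub>m H"
    have t0: "t > 0" using t rho by simp
    have Kc: "K \<in> carrier_mat n n" using c by (simp add: K_def)
    have Kv: "K *\<^sub>v y = complex_of_real (1 / t) \<cdot>\<^sub>v (H *\<^sub>v y)" if "y \<in> carrier_vec n" for y
      using c that by (intro eq_vecI) (auto simp: K_def)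
    have "selfadjoint n K"
      using H Kc by (auto simp: selfadjoint_def Kv conjugate_smult_vec)
    moreover have "spectral_radius K < 1"
    proof -
      obtain k where k: "eigenvalue K k" "spectral_radius K = cmod k"
        using spectral_radius_mem_max(1)[OF Kc n] unfolding spectrum_def by auto
      then obtain v where v: "v \<in> carrier_vec n" "v \<noteq> 0\<^sub>v n" "K *\<^sub>v v = k \<cdot>\<^sub>v v"
        using Kc unfolding eigenvalue_def eigenvector_def by auto
      have "H *\<^sub>v v = complex_of_real t \<cdot>\<^sub>v (K *\<^sub>v v)"
        using t0 c v(1) by (simp add: Kv smult_smult_assoc)
      then have "H *\<^sub>v v = (complex_of_real t * k) \<cdot>\<^sub>v v"
        by (simp add: v(3) smult_smult_assoc)
      then have "eigenvalue H (complex_of_real t * k)"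
        using v c unfolding eigenvalue_def eigenvector_def by auto
      from ev[OF this] have "t * cmod k \<le> \<rho>" using t0 by (simp add: norm_mult)
      then have "t * cmod k < t * 1" using t by simp
      then show ?thesis using k t0 by simp
    qed
    ultimately have "vnorm2 (K *\<^sub>v x) \<le> vnorm2 x" using x by (intro selfadjoint_contraction)
    then show ?thesis
      using t0 x by (simp add: Kv vnorm2_smult norm_divide field_simps)
  qed
  have "((\<lambda>t. t\<^sup>2 * vnorm2 x) \<longlongrightarrow> \<rho>\<^sup>2 * vnorm2 x) (at_right \<rho>)"
    by (intro tendsto_intros)
  moreover have "eventually (\<lambda>t. vnorm2 (H *\<^sub>v x) \<le> t\<^sup>2 * vnorm2 x) (at_right \<rho>)"
    using le by (auto simp: eventually_at_filter)
  ultimately show ?thesis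
    by (rule tendsto_lowerbound) simp
qed

section \<open>The largest singular value as a bound on the operator norm\<close>

lemma largest_singular_value_bounds:
  assumes A: "A \<in> carrier_mat n m" and m: "m > 0"
  shows "largest_singular_value A \<ge> 0"
    and "eigenvalue (mat_adjoint A * A) k \<Longrightarrow> cmod k \<le> (largest_singular_value A)\<^sup>2"
proof -
  have fin: "finite (singular_values A)" and ne: "singular_values A \<noteq> {}"
    using finite_singular_values[OF A] singular_values_nonempty[OF A m] .
  then show "largest_singular_value A \<ge> 0"
    using Max_in[OF fin ne] unfolding largest_singular_value_def singular_values_def by blast
  assume ev: "eigenvalue (mat_adjoint A * A) k"
  then obtain s where s: "s \<ge> 0" "k = complex_of_real (s\<^sup>2)"
    using adjoint_mult_eigenvalue_nonneg[OF A] by blast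
  then have "s \<in> singular_values A" using ev unfolding singular_values_def by auto
  then have "s \<le> largest_singular_value A" using fin unfolding largest_singular_value_def by simp
  then show "cmod k \<le> (largest_singular_value A)\<^sup>2"
    using s by (simp add: power_mono del: of_real_power)
qed

text \<open>With \<open>M\<close> the adjoint of \<open>A\<close> times \<open>A\<close>, the
  squared norm of \<open>A x\<close> is the inner product of \<open>x\<close> and
  \<open>M x\<close>. Cauchy-Schwarz reduces the claim to the self-adjoint matrix \<open>M\<close>,
  whose eigenvalues have modulus at most the square of the largest singular value.\<close>

lemma vnorm2_mult_le_largest_singular_value:
  assumes A: "A \<in> carrier_mat n m" and m: "m > 0" and x: "x \<in> carrier_vec m"
  shows "vnorm2 (A *\<^sub>v x) \<le> (largest_singular_value A)\<^sup>2 * vnorm2 x"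
proof -
  let ?s = "largest_singular_value A"
  define M where "M = mat_adjoint A * A"
  have adj: "mat_adjoint A \<in> carrier_mat m n" using A by (rule mat_adjoint_carrier)
  have M: "M \<in> carrier_mat m m" using adj A by (simp add: M_def)
  have Mv: "M *\<^sub>v v = mat_adjoint A *\<^sub>v (A *\<^sub>v v)" if "v \<in> carrier_vec m" for v
    using A adj that by (simp add: M_def)
  have form: "u \<bullet>c (M *\<^sub>v v) = (A *\<^sub>v u) \<bullet>c (A *\<^sub>v v)"
    if "u \<in> carrier_vec m" "v \<in> carrier_vec m" for u v
    using that A by (simp add: Mv cscalar_prod_mat_adjoint[OF A])
  have swap: "u \<bullet>c v = conjugate (v \<bullet>c u)"
    if "u \<in> carrier_vec d" "v \<in> carrier_vec d" for u v :: "complex vec" and d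
    using that by (auto simp: scalar_prod_def mult.commute intro!: sum.cong)
  have "selfadjoint m M"
    unfolding selfadjoint_def
  proof (intro conjI ballI M)
    fix u v :: "complex vec" assume uv: "u \<in> carrier_vec m" "v \<in> carrier_vec m"
    have "(M *\<^sub>v u) \<bullet>c v = conjugate (v \<bullet>c (M *\<^sub>v u))"
      using M uv by (intro swap[of _ m]) auto
    also have "\<dots> = (A *\<^sub>v u) \<bullet>c (A *\<^sub>v v)"
      unfolding form[OF uv(2,1)] using A uv by (intro swap[of _ n, symmetric]) auto
    finally show "(M *\<^sub>v u) \<bullet>c v = u \<bullet>c (M *\<^sub>v v)" using form uv by simp
  qed
  then have Mx: "vnorm2 (M *\<^sub>v x) \<le> (?s\<^sup>2)\<^sup>2 * vnorm2 x"
    using m x largest_singular_value_bounds(2)[OF A m]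
    by (intro selfadjoint_vnorm2_le) (auto simp: M_def)
  have "complex_of_real (vnorm2 (A *\<^sub>v x)) = x \<bullet>c (M *\<^sub>v x)"
    using form[OF x x] by (simp add: cscalar_prod_self)
  then have "(vnorm2 (A *\<^sub>v x))\<^sup>2 = (cmod (x \<bullet>c (M *\<^sub>v x)))\<^sup>2"
    by (metis norm_of_real power2_abs)
  also have "\<dots> \<le> vnorm2 x * vnorm2 (M *\<^sub>v x)"
    using x M by (intro cscalar_prod_cauchy_schwarz[of _ m]) auto
  also have "\<dots> \<le> vnorm2 x * ((?s\<^sup>2)\<^sup>2 * vnorm2 x)"
    by (intro mult_left_mono Mx vnorm2_nonneg)
  also have "\<dots> = (?s\<^sup>2 * vnorm2 x)\<^sup>2"
    by (simp add: power2_eq_square)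
  finally show ?thesis
    by (rule power2_le_imp_le) (simp add: vnorm2_nonneg)
qed

text \<open>Cauchy-Schwarz for the image of the indicator vector of \<open>S\<close> and the vector
  of values of \<open>f\<close>; both vectors have squared norm at most \<open>N\<close>.\<close>

lemma bilinear_form_le_largest_singular_value:
  fixes A :: "int mat" and f :: "nat \<Rightarrow> int"
  assumes A: "A \<in> carrier_mat N N" and N: "N > 0" and S: "S \<subseteq> {..<N}"
    and f: "\<And>i. i < N \<Longrightarrow> \<bar>f i\<bar> \<le> 1"
  shows "real_of_int (\<Sum>j\<in>S. \<Sum>i<N. A $$ (i, j) * f i)
           \<le> largest_singular_value (map_mat complex_of_int A) * N"
proof -
  let ?A = "map_mat complex_of_int A"
  let ?s = "largest_singular_value ?A"
  define x where "x = vec N (\<lambda>j. if j \<in> S then 1 else 0 :: complex)"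
  define y where "y = vec N (\<lambda>i. complex_of_int (f i))"
  have Ac: "?A \<in> carrier_mat N N" using A by simp
  have x: "x \<in> carrier_vec N" and y: "y \<in> carrier_vec N" by (auto simp: x_def y_def)
  have "vnorm2 x \<le> (\<Sum>j<N. 1)"
    unfolding vnorm2_def by (auto simp: x_def simp del: sum_constant intro!: sum_mono)
  then have nx: "vnorm2 x \<le> N" by simp
  have "vnorm2 y \<le> (\<Sum>j<N. 1)"
    unfolding vnorm2_def using y f
    by (auto simp: y_def abs_square_le_1 simp flip: of_int_abs simp del: sum_constant intro!: sum_mono)
  then have ny: "vnorm2 y \<le> N" by simp
  have "(?A *\<^sub>v x) \<bullet>c y = (\<Sum>i<N.
      (\<Sum>j<N. complex_of_int (A $$ (i, j)) * (if j \<in> S then 1 else 0)) * complex_of_int (f i))"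
    using A by (auto simp: scalar_prod_def lessThan_atLeast0 x_def y_def intro!: sum.cong)
  also have "\<dots> = (\<Sum>i<N. (\<Sum>j\<in>S. complex_of_int (A $$ (i, j))) * complex_of_int (f i))"
  proof -
    have "(\<Sum>j<N. complex_of_int (A $$ (i, j)) * (if j \<in> S then 1 else 0)) =
        (\<Sum>j\<in>S. complex_of_int (A $$ (i, j)))" for i
      using S by (intro sum.mono_neutral_cong_right) auto
    then show ?thesis by simp
  qed
  also have "\<dots> = complex_of_int (\<Sum>j\<in>S. \<Sum>i<N. A $$ (i, j) * f i)"
    by (simp add: sum_distrib_right) (rule sum.swap)
  finally have eq: "(?A *\<^sub>v x) \<bullet>c y = complex_of_int (\<Sum>j\<in>S. \<Sum>i<N. A $$ (i, j) * f i)" .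
  have "(cmod ((?A *\<^sub>v x) \<bullet>c y))\<^sup>2 \<le> vnorm2 (?A *\<^sub>v x) * vnorm2 y"
    using Ac x y by (intro cscalar_prod_cauchy_schwarz[of _ N]) auto
  also have "\<dots> \<le> (?s\<^sup>2 * vnorm2 x) * vnorm2 y"
    by (intro mult_right_mono vnorm2_mult_le_largest_singular_value[OF Ac N x] vnorm2_nonneg)
  also have "\<dots> \<le> (?s\<^sup>2 * N) * N"
    using nx ny by (intro mult_mono mult_left_mono) (auto simp: vnorm2_nonneg)
  also have "\<dots> = (?s * N)\<^sup>2" by (simp add: power2_eq_square)
  finally have "cmod ((?A *\<^sub>v x) \<bullet>c y) \<le> ?s * N"
    by (rule power2_le_imp_le) (simp add: largest_singular_value_bounds(1)[OF Ac N])
  then show ?thesis unfolding eq norm_of_int by linarith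
qed

section \<open>Counting the columns of a low-rank matrix over a finite field\<close>

text \<open>A vector of \<open>S\<close> outside the span of \<open>U\<close> could be adjoined to
  \<open>U\<close> without losing independence, against maximality.\<close>

lemma (in vec_space) span_maximal_lin_indpt:
  assumes S: "S \<subseteq> carrier_vec n" and U: "maximal U (\<lambda>T. T \<subseteq> S \<and> lin_indpt T)"
  shows "S \<subseteq> span U"
proof
  fix s assume s: "s \<in> S"
  have US: "U \<subseteq> S" and li: "lin_indpt U" using U unfolding maximal_def by auto
  have Uc: "U \<subseteq> carrier_vec n" using US S by blast
  show "s \<in> span U"
  proof (rule ccontr)
    assume ns: "s \<notin> span U"
    then have "s \<notin> U" using span_mem[of U s] Uc by auto
    moreover have "lin_indpt (U \<union> {s})"
      using lin_dep_iff_in_span[of U s] ns li s S Uc calculation by auto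
    ultimately show False using U s unfolding maximal_def by blast
  qed
qed

text \<open>A maximal independent set \<open>U\<close> of columns has as many elements as the rank,
  and each column is determined by its coefficients over \<open>U\<close>.\<close>

lemma card_cols_le_rank:
  fixes L :: "'a::{field,finite} mat"
  assumes L: "L \<in> carrier_mat n m"
  shows "card (set (cols L)) \<le> CARD('a) ^ vec_space.rank n L"
proof -
  interpret vec_space "TYPE('a)" n .
  have cols: "set (cols L) \<subseteq> carrier_vec n" using L cols_dim by blast
  obtain U where U: "finite U" "maximal U (\<lambda>T. T \<subseteq> set (cols L) \<and> lin_indpt T)"
  proof -
    \<comment> \<open>The empty set is the seed from which a maximal independent set of columns is
      obtained; its independence is inherited from a finite basis.\<close>
    have "lin_indpt {}"
      by (metis empty_subsetI fin_dim finite_basis_exists subset_li_is_li vec_vs vectorspace.basis_def)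
    then show ?thesis
      using maximal_exists_superset[of "set (cols L)" "\<lambda>T. T \<subseteq> set (cols L) \<and> lin_indpt T" "{}"] that
      by auto
  qed
  have Uc: "U \<subseteq> carrier_vec n" using U(2) cols unfolding maximal_def by auto
  have "set (cols L) \<subseteq> span U" by (rule span_maximal_lin_indpt[OF cols U(2)])
  \<comment> \<open>Restricting the coefficient functions to \<open>U\<close> leaves only finitely
    many of them.\<close>
  also have "span U \<subseteq> (\<lambda>f. lincomb f U) ` (U \<rightarrow>\<^sub>E UNIV)"
  proof
    fix v assume "v \<in> span U"
    then obtain f where "v = lincomb f U"
      using finite_in_span[OF U(1) Uc] by blast
    also have "\<dots> = lincomb (restrict f U) U"
      by (rule lincomb_cong) (use Uc in auto)
    finally show "v \<in> (\<lambda>f. lincomb f U) ` (U \<rightarrow>\<^sub>E UNIV)"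
      by (rule image_eqI[where x = "restrict f U"]) simp
  qed
  finally have "card (set (cols L)) \<le> card ((\<lambda>f. lincomb f U) ` (U \<rightarrow>\<^sub>E (UNIV :: 'a set)))"
    using U(1) by (intro card_mono finite_imageI finite_PiE) auto
  also have "\<dots> \<le> card (U \<rightarrow>\<^sub>E (UNIV :: 'a set))"
    using U(1) by (intro card_image_le finite_PiE) auto
  also have "\<dots> = CARD('a) ^ rank L"
    using U(1) rank_card_indpt[OF L U(2)] by (simp add: card_PiE)
  finally show ?thesis .
qed

section \<open>Correlation with a Booleanized matrix and the rigidity bound\<close>

lemma sum_booleanize_le:
  fixes A :: "int mat" and L :: "'p::prime_card mod_ring mat"
  assumes A: "A \<in> carrier_mat N N" and N: "N > 0" and L: "L \<in> carrier_mat N N"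
    and r: "vec_space.rank N L \<le> r"
  shows "real_of_int (\<Sum>j<N. \<Sum>i<N. A $$ (i, j) * booleanize (L $$ (i, j)))
           \<le> real CARD('p) ^ r * (largest_singular_value (map_mat complex_of_int A) * N)"
proof -
  let ?s = "largest_singular_value (map_mat complex_of_int A)"
  have s: "?s \<ge> 0" using largest_singular_value_bounds(1)[of _ N N] A N by simp
  define V where "V = col L ` {..<N}"
  have "V = set (cols L)" using L by (auto simp: V_def cols_def)
  then have "card V \<le> CARD('p) ^ vec_space.rank N L" using card_cols_le_rank[OF L] by simp
  also have "\<dots> \<le> CARD('p) ^ r" using r by (intro power_increasing) auto
  finally have cV: "real (card V) \<le> real CARD('p) ^ r"
    by (metis of_nat_le_iff of_nat_power)
  have "(\<Sum>j<N. \<Sum>i<N. A $$ (i, j) * booleanize (L $$ (i, j)))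
      = (\<Sum>v\<in>V. \<Sum>j\<in>{j\<in>{..<N}. col L j = v}. \<Sum>i<N. A $$ (i, j) * booleanize (L $$ (i, j)))"
    unfolding V_def by (rule sum.image_gen) simp
  \<comment> \<open>Within a class the Booleanized column depends on \<open>v\<close> alone, so a
    single sign vector serves all its columns.\<close>
  also have "\<dots> = (\<Sum>v\<in>V. \<Sum>j\<in>{j\<in>{..<N}. col L j = v}. \<Sum>i<N. A $$ (i, j) * booleanize (v $ i))"
    using L by (intro sum.cong refl) auto
  finally have eq: "(\<Sum>j<N. \<Sum>i<N. A $$ (i, j) * booleanize (L $$ (i, j))) = \<dots>" .
  have "real_of_int (\<Sum>j<N. \<Sum>i<N. A $$ (i, j) * booleanize (L $$ (i, j)))
      \<le> (\<Sum>v\<in>V. ?s * N)"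
    \<comment> \<open>Instantiating the set with \<open>V\<close> moves the coercion through the
      outer sum only, so each class keeps the shape of the bilinear bound.\<close>
    unfolding eq of_int_sum[of _ V]
    by (intro sum_mono bilinear_form_le_largest_singular_value[OF A N]) (auto simp: booleanize_def)
  also have "\<dots> \<le> real CARD('p) ^ r * (?s * N)"
    using cV s by (simp add: mult_right_mono)
  finally show ?thesis .
qed

text \<open>For signs, 1 minus the product is 0 where they agree and 2 where they differ.\<close>

lemma bool_disagreement_eq_sum:
  fixes A :: "int mat" and L :: "'p::prime_card mod_ring mat"
  assumes A: "A \<in> carrier_mat N N" and el: "elements_mat A \<subseteq> {- 1, 1}"
  shows "2 * int (bool_disagreement A L)
           = (int N)\<^sup>2 - (\<Sum>j<N. \<Sum>i<N. A $$ (i, j) * booleanize (L $$ (i, j)))"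
proof -
  let ?D = "\<lambda>i j. A $$ (i, j) \<noteq> booleanize (L $$ (i, j))"
  have A1: "A $$ (i, j) = - 1 \<or> A $$ (i, j) = 1" if "i < N" "j < N" for i j
    using el elements_matI[OF A that refl] by auto
  have "{(i, j). i < N \<and> j < N \<and> ?D i j} = {z \<in> {..<N} \<times> {..<N}. ?D (fst z) (snd z)}"
    by auto
  then have "int (bool_disagreement A L) = (\<Sum>z\<in>{..<N} \<times> {..<N}. if ?D (fst z) (snd z) then 1 else 0)"
    using A unfolding bool_disagreement_def by (simp add: sum.If_cases Int_def)
  also have "\<dots> = (\<Sum>i<N. \<Sum>j<N. if ?D i j then 1 else 0)"
    by (simp add: sum.cartesian_product split_def)
  also have "\<dots> = (\<Sum>j<N. \<Sum>i<N. if ?D i j then 1 else 0)"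
    by (rule sum.swap)
  finally have "2 * int (bool_disagreement A L) = (\<Sum>j<N. \<Sum>i<N. 2 * (if ?D i j then 1 else 0))"
    by (simp only: sum_distrib_left)
  also have "\<dots> = (\<Sum>j<N. \<Sum>i<N. 1 - A $$ (i, j) * booleanize (L $$ (i, j)))"
    using A1 by (intro sum.cong refl) (fastforce simp: booleanize_def)
  also have "\<dots> = (int N)\<^sup>2 - (\<Sum>j<N. \<Sum>i<N. A $$ (i, j) * booleanize (L $$ (i, j)))"
    by (simp add: sum_subtractf power2_eq_square)
  finally show ?thesis .
qed

theorem theorem1p1:
  shows "\<exists>c::real. c > 1 \<and>
    (\<forall>(N::nat) (A::int mat) (r::nat).
       N > 0 \<longrightarrow> A \<in> carrier_mat N N \<longrightarrow> elements_mat A \<subseteq> {- 1, 1} \<longrightarrow>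
       real (bool_rigidity TYPE('p::prime_card) A r)
         \<ge> (real N)\<^sup>2 * (1 / 2 - c ^ r * largest_singular_value (map_mat complex_of_int A) / real N))"
proof (intro exI[of _ "real CARD('p)"] conjI allI impI)
  show "1 < real CARD('p)"
    using prime_gt_1_nat[OF prime_card] by simp
next
  fix N :: nat and A :: "int mat" and r :: nat
  assume N: "N > 0" and A: "A \<in> carrier_mat N N" and el: "elements_mat A \<subseteq> {- 1, 1}"
  let ?s = "largest_singular_value (map_mat complex_of_int A)"
  have s: "?s \<ge> 0" using largest_singular_value_bounds(1)[of _ N N] A N by simp
  \<comment> \<open>The minimum is attained, so it suffices to bound the disagreement with one
    matrix \<open>L\<close>.\<close>
  obtain L :: "'p mod_ring mat" where L: "L \<in> carrier_mat N N" "vec_space.rank N L \<le> r"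
    and eq: "bool_rigidity TYPE('p) A r = bool_disagreement A L"
    using bool_rigidity_attained[of A r, where 'p='p] A by auto
  let ?C = "real CARD('p) ^ r * (?s * N)"
  have "2 * real (bool_disagreement A L) \<ge> (real N)\<^sup>2 - ?C"
    using arg_cong[OF bool_disagreement_eq_sum[OF A el, of L], of real_of_int]
      sum_booleanize_le[OF A N L] by simp
  \<comment> \<open>Halving the previous inequality subtracts only half of \<open>?C\<close>, while
    the claim subtracts all of it; nonnegativity closes this gap.\<close>
  moreover have "?C \<ge> 0" using s by simp
  moreover have "(real N)\<^sup>2 * (1 / 2 - real CARD('p) ^ r * ?s / real N) = (real N)\<^sup>2 / 2 - ?C"
    using N by (simp add: field_simps power2_eq_square)
  ultimately show "real (bool_rigidity TYPE('p) A r)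
      \<ge> (real N)\<^sup>2 * (1 / 2 - real CARD('p) ^ r * ?s / real N)"
    unfolding eq by simp
qed

end
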